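(* There is exactly one sequence $w^*=(w_j^* )_{j\ge 0}$ of positive real numbers satisfying $$3(w_0^* )^2+(w_0^*+w_1^* )^2=10,$$ $$(w_{j-1}^*+w_j^* )^2+(w_j^*+w_{j+1}^* )^2+2(w_j^* )^2=10\qquad(j\ge 1),$$ $$w_j^*\longrightarrow 1\quad(j\to\infty).$$ It is the unique minimizer of $$\mathcal J(w)=b(w_0)+\sum_{j\ge 0}\psi(w_j,w_{j+1})$$ on the set $\{w=(w_j)_{j\ge0}:\ w_j\ge 0 \text{ for all } j,\ w-1\in\ell^2(\mathbb N_0)\}$. Moreover, there is a constant $c_*\neq 0$ such that, as $j\to\infty$, $$w_j^*-1=c_*\lambda_s^j+O(|\lambda_s|^{2j}),\qquad \lambda_s=\frac{-3+\sqrt5}{2}.$$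
   Context: Here $$b(x)=\frac{x^3}{3}-4x+\frac{11}{3},\qquad \psi(x,y)=\frac{(x+y)^3}{3}+\frac{2x^3}{3}-6x-4y+\frac{20}{3}.$$ $\mathbb N_0=\{0,1,2,\dots\}$, and $w-1$ denotes the sequence $(w_j-1)_{j\ge0}$. Since $\psi(1,1)=0$ and $\nabla\psi(1,1)=0$, the series defining $\mathcal J(w)$ converges absolutely for every $w$ in the indicated set. *)

theory Defs
  imports "HOL-Analysis.Analysis" "HOL-Library.Landau_Symbols"
begin

definition b_cost :: "real \<Rightarrow> real" where
  "b_cost x = x ^ 3 / 3 - 4 * x + 11 / 3"

definition psi_cost :: "real \<Rightarrow> real \<Rightarrow> real" where
  "psi_cost x y = (x + y) ^ 3 / 3 + 2 * x ^ 3 / 3 - 6 * x - 4 * y + 20 / 3"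

definition admissible :: "(nat \<Rightarrow> real) set" where
  "admissible = {w. (\<forall>j. w j \<ge> 0) \<and> summable (\<lambda>j. (w j - 1) ^ 2)}"

text \<open>The infinite sum below is only meaningful where it converges; on \<open>admissible\<close> it
  converges absolutely, as shown in \<open>psi_cost_abs_summable\<close>.\<close>

definition J_functional :: "(nat \<Rightarrow> real) \<Rightarrow> real" where
  "J_functional w = b_cost (w 0) + (\<Sum>j. psi_cost (w j) (w (j + 1)))"

definition lambda_s :: real where
  "lambda_s = (- 3 + sqrt 5) / 2"

definition positive_solution :: "(nat \<Rightarrow> real) \<Rightarrow> bool" where
  "positive_solution w \<longleftrightarrow>
     (\<forall>j. w j > 0) \<and>
     3 * (w 0) ^ 2 + (w 0 + w 1) ^ 2 = 10 \<and>
     (\<forall>j\<ge>1. (w (j - 1) + w j) ^ 2 + (w j + w (j + 1)) ^ 2 + 2 * (w j) ^ 2 = 10) \<and>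
     w \<longlonglongrightarrow> 1"

lemma psi_cost_expand:
  "psi_cost (1 + x) (1 + y) = (x + y)\<^sup>2 * (2 + (x + y) / 3) + x\<^sup>2 * (2 + 2 * x / 3)"
  unfolding psi_cost_def by (simp add: field_simps power2_eq_square power3_eq_cube)

lemma psi_cost_abs_summable:
  assumes "w \<in> admissible"
  shows "summable (\<lambda>j. \<bar>psi_cost (w j) (w (j + 1))\<bar>)"
proof -
  define u where "u j = w j - 1" for j
  have su: "summable (\<lambda>j. (u j)\<^sup>2)"
    using assms by (simp add: admissible_def u_def)
  have "(\<lambda>j. (u j)\<^sup>2) \<longlonglongrightarrow> 0"
    using su by (rule summable_LIMSEQ_zero)
  then have "\<forall>\<^sub>F j in sequentially. (u j)\<^sup>2 < 1"
    by (rule order_tendstoD) simp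
  then obtain N where N: "\<And>j. j \<ge> N \<Longrightarrow> (u j)\<^sup>2 < 1"
    by (auto simp: eventually_sequentially)
  have ub: "\<bar>u j\<bar> \<le> 1" if "j \<ge> N" for j
    using N[OF that] by (simp add: abs_square_less_1 less_imp_le)
  have bound: "\<bar>psi_cost (w j) (w (j + 1))\<bar> \<le> 9 * (u j)\<^sup>2 + 6 * (u (j + 1))\<^sup>2"
    if "j \<ge> N" for j
  proof -
    define x y where "x = u j" and "y = u (j + 1)"
    have xy: "\<bar>x\<bar> \<le> 1" "\<bar>y\<bar> \<le> 1"
      using ub that by (auto simp: x_def y_def)
    have eq: "psi_cost (w j) (w (j + 1)) =
        (x + y)\<^sup>2 * (2 + (x + y) / 3) + x\<^sup>2 * (2 + 2 * x / 3)"
      using psi_cost_expand[of x y] by (simp add: x_def y_def u_def)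
    have p: "0 \<le> 2 + (x + y) / 3" "2 + (x + y) / 3 \<le> 3" "0 \<le> 2 + 2 * x / 3" "2 + 2 * x / 3 \<le> 3"
      using xy by (auto simp: abs_le_iff field_simps)
    have "(x + y)\<^sup>2 * (2 + (x + y) / 3) \<le> (x + y)\<^sup>2 * 3" "x\<^sup>2 * (2 + 2 * x / 3) \<le> x\<^sup>2 * 3"
      using p by (intro mult_left_mono; simp)+
    moreover have "0 \<le> (x + y)\<^sup>2 * (2 + (x + y) / 3)" "0 \<le> x\<^sup>2 * (2 + 2 * x / 3)"
      using p by (intro mult_nonneg_nonneg; simp)+
    moreover have "(x + y)\<^sup>2 \<le> 2 * x\<^sup>2 + 2 * y\<^sup>2"
      using zero_le_power2[of "x - y"] by (simp add: power2_sum power2_diff)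
    ultimately show ?thesis
      unfolding eq x_def[symmetric] y_def[symmetric] by linarith
  qed
  have "summable (\<lambda>j. (u (j + 1))\<^sup>2)"
    using su by (simp add: summable_Suc_iff[of "\<lambda>j. (u j)\<^sup>2"])
  then have "summable (\<lambda>j. 9 * (u j)\<^sup>2 + 6 * (u (j + 1))\<^sup>2)"
    using su by (intro summable_add summable_mult)
  then show ?thesis
    by (rule summable_comparison_test') (use bound in auto)
qed

end

theory Submission
  imports Defs
begin

text \<open>
  The equations of the statement are the Euler--Lagrange equations of \<^const>\<open>J_functional\<close>.  On
  nonnegative sequences every term of the functional is a convex cubic, and convexity gives
  the variational half of the theorem with explicit cubic remainders.

  \<^item> \<^emph>\<open>Solutions are strict minimizers.\<close>  Expand each cubic around a stationary \<open>w\<close>.  The linear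
    terms cancel by stationarity, apart from one boundary term, which vanishes at infinity
    because \<open>w\<close> and the competitor both tend to 1.  What remains is a sum of
    nonnegative remainders, and the remainder at \<open>k\<close> is positive as soon as the competitor
    differs from \<open>w\<close> at \<open>k\<close> (\<open>stationary_gap\<close>).  Hence a positive solution that is admissible is
    the only minimizer, and there is at most one such solution.

  \<^item> \<^emph>\<open>A minimizer exists.\<close>  Replacing two sequences by their midpoint lowers the functional by
    at least \<open>\<bar>v k - w k\<bar> ^ 3 / 4\<close> for each \<open>k\<close> (\<open>J_midpoint\<close>), so a minimizing sequence is Cauchy in
    every coordinate and converges pointwise.  Lower semicontinuity follows from \<open>psi_cost \<ge> 0\<close>, and the limit stays admissible because \<open>psi_cost x y\<close> dominates
    \<open>(x - 1)\<^sup>2\<close>.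

  \<^item> \<^emph>\<open>Minimizers are positive solutions.\<close>  Vary one coordinate.  Where \<open>w k > 0\<close> this gives the
    equation at \<open>k\<close>, which in turn bounds \<open>(w k)\<^sup>2\<close> by \<open>5 / 2\<close>.  If \<open>w k = 0\<close>, the derivative at 0
    is the sum of the squares of the two neighbours minus 10, hence negative, so that a small
    positive value would be cheaper.

  The asymptotics concern \<open>u = w - 1\<close>, which satisfies
  \<open>u j + 3 * u (j + 1) + u (j + 2) = \<close> a quadratic remainder.  The characteristic roots are
  \<open>lambda_s\<close> and its inverse, so a solution tending to 0 must follow \<open>lambda_s\<close>.  Once
  \<open>u\<close> is small, each \<open>\<bar>u (j + 1)\<bar>\<close> lies between a quarter and a half of \<open>\<bar>u j\<bar>\<close>.  The upper bound
  gives admissibility and makes the remainder \<open>O(4^-j)\<close>, which is small against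
  \<open>\<bar>lambda_s\<bar> ^ j\<close>.  Treating the remainder as a forcing term
  (\<open>linear_recurrence_asymptotics\<close>) yields \<open>u = O(\<bar>lambda_s\<bar> ^ j)\<close>; the remainder is then
  \<open>O(\<bar>lambda_s\<bar> ^ (2 * j))\<close>, and a second application yields the claimed expansion.  If its
  leading coefficient were 0, then \<open>u\<close> would decay like \<open>\<bar>lambda_s\<bar> ^ (2 * j)\<close>, faster than
  \<open>4^-j\<close>, against the lower bound.
\<close>

section \<open>The stationarity equations and the truncated functional\<close>

text \<open>The value 0 to the left of the sequence turns the boundary equation
  \<open>3 * (w 0)\<^sup>2 + (w 0 + w 1)\<^sup>2 = 10\<close> into the case \<open>k = 0\<close> of the interior one.\<close>

definition prev :: "(nat \<Rightarrow> real) \<Rightarrow> nat \<Rightarrow> real" where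
  "prev w k = (case k of 0 \<Rightarrow> 0 | Suc i \<Rightarrow> w i)"

definition stationary :: "(nat \<Rightarrow> real) \<Rightarrow> nat \<Rightarrow> bool" where
  "stationary w k \<longleftrightarrow> (prev w k + w k)\<^sup>2 + (w k + w (Suc k))\<^sup>2 + 2 * (w k)\<^sup>2 = 10"

definition J_upto :: "nat \<Rightarrow> (nat \<Rightarrow> real) \<Rightarrow> real" where
  "J_upto n w = b_cost (w 0) + (\<Sum>j<n. psi_cost (w j) (w (Suc j)))"

lemma prev_simps [simp]: "prev w 0 = 0" "prev w (Suc i) = w i"
  by (simp_all add: prev_def)

lemma positive_solution_iff:
  "positive_solution w \<longleftrightarrow> (\<forall>k. w k > 0) \<and> (\<forall>k. stationary w k) \<and> w \<longlonglongrightarrow> 1"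
proof -
  have "(\<forall>k. stationary w k) \<longleftrightarrow> stationary w 0 \<and> (\<forall>j\<ge>1. stationary w j)"
    by (metis One_nat_def Suc_leI not_gr_zero)
  moreover have "stationary w 0 \<longleftrightarrow> 3 * (w 0)\<^sup>2 + (w 0 + w 1)\<^sup>2 = 10"
    by (auto simp: stationary_def)
  moreover have "stationary w j \<longleftrightarrow>
      (w (j - 1) + w j)\<^sup>2 + (w j + w (j + 1))\<^sup>2 + 2 * (w j)\<^sup>2 = 10" if "j \<ge> 1" for j
    using that by (cases j) (auto simp: stationary_def)
  ultimately show ?thesis
    unfolding positive_solution_def by auto
qed

lemma J_upto_tendsto:
  assumes "w \<in> admissible"
  shows "(\<lambda>n. J_upto n w) \<longlonglongrightarrow> J_functional w"
proof -
  have "summable (\<lambda>j. psi_cost (w j) (w (j + 1)))"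
    using psi_cost_abs_summable[OF assms] by (rule summable_rabs_cancel)
  then have "(\<lambda>n. \<Sum>j<n. psi_cost (w j) (w (j + 1))) \<longlonglongrightarrow> (\<Sum>j. psi_cost (w j) (w (j + 1)))"
    by (rule summable_LIMSEQ)
  then show ?thesis
    unfolding J_upto_def J_functional_def by (intro tendsto_add tendsto_const) simp
qed

lemma admissible_tendsto:
  assumes "w \<in> admissible"
  shows "w \<longlonglongrightarrow> 1"
proof -
  have "summable (\<lambda>j. (w j - 1)\<^sup>2)"
    using assms by (simp add: admissible_def)
  then have "(\<lambda>j. (w j - 1)\<^sup>2) \<longlonglongrightarrow> 0"
    by (rule summable_LIMSEQ_zero)
  then have "(\<lambda>j. w j - 1) \<longlonglongrightarrow> 0"
    by simp
  then show ?thesis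
    by (simp add: LIM_zero_cancel)
qed

lemma admissible_nonneg: "w \<in> admissible \<Longrightarrow> w j \<ge> 0"
  by (simp add: admissible_def)

section \<open>Stationary sequences are strict minimizers\<close>

text \<open>The error of the first-order Taylor expansion of \<open>b ^ 3 / 3\<close> around \<open>a\<close>.\<close>

definition cubic_rem :: "real \<Rightarrow> real \<Rightarrow> real" where
  "cubic_rem a b = (b - a)\<^sup>2 * (b + 2 * a) / 3"

lemma cube_expand: "b ^ 3 / 3 = a ^ 3 / 3 + a\<^sup>2 * (b - a) + cubic_rem a b"
  by (simp add: cubic_rem_def field_simps power2_eq_square power3_eq_cube)

lemma cubic_rem_nonneg: "a \<ge> 0 \<Longrightarrow> b \<ge> 0 \<Longrightarrow> cubic_rem a b \<ge> 0"
  by (simp add: cubic_rem_def)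

text \<open>Summation by parts: stationarity at \<open>n\<close> is what turns the boundary term at \<open>n\<close> into the one
  at \<open>Suc n\<close>.  The remainders of the cubes \<open>(w j + w (j + 1)) ^ 3\<close> are dropped, since those of
  \<open>w j ^ 3\<close> already detect any difference between \<open>v\<close> and \<open>w\<close>.\<close>

lemma J_upto_diff_ge:
  assumes st: "\<And>k. stationary w k" and w: "\<And>k. w k \<ge> 0" and v: "\<And>k. v k \<ge> 0"
  shows "J_upto n v - J_upto n w \<ge>
    (\<Sum>j<n. 2 * cubic_rem (w j) (v j)) + ((prev w n + w n)\<^sup>2 - 4) * (v n - w n)"
proof (induction n)
  case 0
  show ?case
    using cube_expand[of "v 0" "w 0"] cubic_rem_nonneg[OF w v, of 0 0]
    by (simp add: J_upto_def b_cost_def algebra_simps)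
next
  case (Suc n)
  define D where "D = J_upto n v - J_upto n w"
  define S where "S = (\<Sum>j<n. 2 * cubic_rem (w j) (v j))"
  define P where "P = (prev w n + w n)\<^sup>2"
  define Q where "Q = (w n + w (Suc n))\<^sup>2"
  have IH: "D \<ge> S + (P - 4) * (v n - w n)"
    using Suc by (simp add: D_def S_def P_def)
  have e: "P = 10 - Q - 2 * (w n)\<^sup>2"
    using st[of n] by (simp add: stationary_def P_def Q_def)
  have c1: "(v n + v (Suc n)) ^ 3 / 3 \<ge>
      (w n + w (Suc n)) ^ 3 / 3 + Q * (v n + v (Suc n) - (w n + w (Suc n)))"
    using cube_expand[of "v n + v (Suc n)" "w n + w (Suc n)"]
      cubic_rem_nonneg[of "w n + w (Suc n)" "v n + v (Suc n)"] w v
    by (simp add: Q_def)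
  have c2: "2 * v n ^ 3 / 3 = 2 * w n ^ 3 / 3 + 2 * ((w n)\<^sup>2 * (v n - w n)) + 2 * cubic_rem (w n) (v n)"
    using cube_expand[of "v n" "w n"] by linarith
  have "J_upto (Suc n) v - J_upto (Suc n) w
      = D + (psi_cost (v n) (v (Suc n)) - psi_cost (w n) (w (Suc n)))"
    by (simp add: D_def J_upto_def)
  moreover have "psi_cost (v n) (v (Suc n)) - psi_cost (w n) (w (Suc n)) \<ge>
      Q * (v n + v (Suc n) - (w n + w (Suc n))) + 2 * ((w n)\<^sup>2 * (v n - w n))
      + 2 * cubic_rem (w n) (v n) - 6 * (v n - w n) - 4 * (v (Suc n) - w (Suc n))"
    using c1 c2 unfolding psi_cost_def by argo
  moreover have "(P - 4) * (v n - w n) + (Q * (v n + v (Suc n) - (w n + w (Suc n)))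
      + 2 * ((w n)\<^sup>2 * (v n - w n)) + 2 * cubic_rem (w n) (v n)
      - 6 * (v n - w n) - 4 * (v (Suc n) - w (Suc n)))
      = 2 * cubic_rem (w n) (v n) + (Q - 4) * (v (Suc n) - w (Suc n))"
    unfolding e by (simp add: algebra_simps)
  ultimately have "J_upto (Suc n) v - J_upto (Suc n) w \<ge>
      S + 2 * cubic_rem (w n) (v n) + (Q - 4) * (v (Suc n) - w (Suc n))"
    using IH by linarith
  then show ?case
    by (simp add: S_def Q_def)
qed

text \<open>The boundary term of \<open>J_upto_diff_ge\<close> tends to 0, since \<open>v - w\<close> does and
  \<open>(w n + w (Suc n))\<^sup>2\<close> converges.\<close>

lemma stationary_gap:
  assumes st: "\<And>k. stationary w k" and w: "w \<in> admissible" and v: "v \<in> admissible"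
  shows "J_functional v - J_functional w \<ge> 2 * cubic_rem (w k) (v k)"
proof -
  note lw = admissible_tendsto[OF w] and lv = admissible_tendsto[OF v]
  note nonneg = admissible_nonneg[OF w] admissible_nonneg[OF v]
  define B where "B n = ((w n + w (Suc n))\<^sup>2 - 4) * (v (Suc n) - w (Suc n))" for n
  have "B \<longlonglongrightarrow> ((1 + 1)\<^sup>2 - 4) * (1 - 1)"
    unfolding B_def by (intro tendsto_intros lw LIMSEQ_Suc[OF lw] LIMSEQ_Suc[OF lv])
  then have B0: "B \<longlonglongrightarrow> 0" by simp
  have lim: "(\<lambda>n. J_upto (Suc n) v - J_upto (Suc n) w - B n)
      \<longlonglongrightarrow> J_functional v - J_functional w - 0"
    by (intro tendsto_intros LIMSEQ_Suc[OF J_upto_tendsto] v w B0)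
  have "2 * cubic_rem (w k) (v k) \<le> J_upto (Suc n) v - J_upto (Suc n) w - B n" if "n \<ge> k" for n
  proof -
    have "2 * cubic_rem (w k) (v k) \<le> (\<Sum>j<Suc n. 2 * cubic_rem (w j) (v j))"
      using that by (intro member_le_sum) (auto intro!: cubic_rem_nonneg nonneg)
    then show ?thesis
      using J_upto_diff_ge[where w = w and v = v and n = "Suc n", OF st nonneg] by (simp add: B_def)
  qed
  then have "\<forall>\<^sub>F n in sequentially.
      2 * cubic_rem (w k) (v k) \<le> J_upto (Suc n) v - J_upto (Suc n) w - B n"
    by (auto simp: eventually_sequentially)
  from tendsto_lowerbound[OF lim this] show ?thesis by simp
qed

lemma positive_stationary_unique_minimizer:
  assumes st: "\<And>k. stationary w k" and pos: "\<And>k. w k > 0" and w: "w \<in> admissible"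
  shows "is_arg_min J_functional (\<lambda>v. v \<in> admissible) v \<longleftrightarrow> v = w"
proof
  have min: "J_functional w \<le> J_functional v" if "v \<in> admissible" for v
    using stationary_gap[OF st w that, of 0]
      cubic_rem_nonneg[of "w 0" "v 0"] admissible_nonneg[OF w] admissible_nonneg[OF that]
    by fastforce
  show "is_arg_min J_functional (\<lambda>v. v \<in> admissible) v" if "v = w"
    using that w min by (auto simp: is_arg_min_linorder)
  assume a: "is_arg_min J_functional (\<lambda>v. v \<in> admissible) v"
  then have v: "v \<in> admissible" and le: "J_functional v \<le> J_functional w"
    using w by (auto simp: is_arg_min_linorder)
  show "v = w"
  proof
    fix k
    have "2 * cubic_rem (w k) (v k) \<le> 0"
      using stationary_gap[OF st w v, of k] le by linarith
    moreover have "v k + 2 * w k > 0"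
      using pos[of k] admissible_nonneg[OF v, of k] by linarith
    ultimately have "(v k - w k)\<^sup>2 \<le> 0"
      by (simp add: cubic_rem_def mult_le_0_iff)
    then show "v k = w k" by simp
  qed
qed

section \<open>Existence of a minimizer\<close>

text \<open>Coercivity of the functional with respect to \<open>w - 1\<close> in \<open>\<ell>\<^sup>2\<close>.\<close>

lemma psi_cost_lower:
  assumes "x \<ge> 0" "y \<ge> 0"
  shows "psi_cost x y \<ge> (x - 1)\<^sup>2"
proof -
  define s t where "s = x - 1" and "t = y - 1"
  have st: "s \<ge> -1" "t \<ge> -1" using assms by (auto simp: s_def t_def)
  have "psi_cost x y = (s + t)\<^sup>2 * (2 + (s + t) / 3) + s\<^sup>2 * (2 + 2 * s / 3)"
    using psi_cost_expand[of s t] by (simp add: s_def t_def)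
  moreover have "2 + (s + t) / 3 \<ge> 0"
    using st by argo
  then have "(s + t)\<^sup>2 * (2 + (s + t) / 3) \<ge> 0"
    by (intro mult_nonneg_nonneg) auto
  moreover have "s\<^sup>2 * (2 + 2 * s / 3) \<ge> s\<^sup>2 * 1"
    using st by (intro mult_left_mono) auto
  ultimately show ?thesis by (simp add: s_def)
qed

lemma psi_cost_nonneg: "x \<ge> 0 \<Longrightarrow> y \<ge> 0 \<Longrightarrow> psi_cost x y \<ge> 0"
  using psi_cost_lower[of x y] zero_le_power2[of "x - 1"] by linarith

lemma b_cost_lower:
  assumes "x \<ge> 0"
  shows "b_cost x \<ge> - 5 / 3"
proof -
  \<comment> \<open>\<^const>\<open>b_cost\<close> has its minimum over \<open>x \<ge> 0\<close> at the critical point 2, with value \<open>- 5 / 3\<close>.\<close>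
  have "b_cost x + 5 / 3 = (x - 2)\<^sup>2 * (x + 4) / 3"
    by (simp add: b_cost_def field_simps power2_eq_square power3_eq_cube)
  moreover have "(x - 2)\<^sup>2 * (x + 4) / 3 \<ge> 0" using assms by simp
  ultimately show ?thesis by linarith
qed

lemma J_upto_mono:
  assumes "\<And>k. w k \<ge> 0" "m \<le> n"
  shows "J_upto m w \<le> J_upto n w"
  unfolding J_upto_def using assms
  by (intro add_left_mono sum_mono2) (auto intro: psi_cost_nonneg)

lemma J_upto_le:
  assumes "w \<in> admissible"
  shows "J_upto n w \<le> J_functional w"
  using J_upto_tendsto[OF assms]
  by (rule Lim_bounded2[of _ _ n]) (auto intro: J_upto_mono admissible_nonneg assms)

lemma J_functional_lower:
  assumes "w \<in> admissible"
  shows "J_functional w \<ge> - 5 / 3"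
  using J_upto_le[OF assms, of 0] b_cost_lower[OF admissible_nonneg[OF assms]]
  by (simp add: J_upto_def) (meson order_trans)

definition midpoint_seq :: "(nat \<Rightarrow> real) \<Rightarrow> (nat \<Rightarrow> real) \<Rightarrow> nat \<Rightarrow> real" where
  "midpoint_seq v w j = (v j + w j) / 2"

lemma midpoint_seq_admissible:
  assumes v: "v \<in> admissible" and w: "w \<in> admissible"
  shows "midpoint_seq v w \<in> admissible"
proof -
  have dom: "summable (\<lambda>j. (v j - 1)\<^sup>2 + (w j - 1)\<^sup>2)"
    using v w by (auto simp: admissible_def intro: summable_add)
  have le: "norm ((midpoint_seq v w j - 1)\<^sup>2) \<le> (v j - 1)\<^sup>2 + (w j - 1)\<^sup>2" for j
  proof -
    have "(v j - 1)\<^sup>2 + (w j - 1)\<^sup>2 - (midpoint_seq v w j - 1)\<^sup>2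
        = ((v j - 1) - (w j - 1))\<^sup>2 / 4 + (v j - 1)\<^sup>2 / 2 + (w j - 1)\<^sup>2 / 2"
      by (simp add: midpoint_seq_def field_simps power2_eq_square)
    moreover have "((v j - 1) - (w j - 1))\<^sup>2 / 4 + (v j - 1)\<^sup>2 / 2 + (w j - 1)\<^sup>2 / 2 \<ge> 0"
      by simp
    ultimately have "(midpoint_seq v w j - 1)\<^sup>2 \<le> (v j - 1)\<^sup>2 + (w j - 1)\<^sup>2"
      by linarith
    then show ?thesis by simp
  qed
  have "summable (\<lambda>j. (midpoint_seq v w j - 1)\<^sup>2)"
    using dom le by (rule summable_comparison_test')
  then show ?thesis
    using admissible_nonneg[OF v] admissible_nonneg[OF w]
    by (auto simp: admissible_def midpoint_seq_def)
qed

text \<open>For a cube, \<open>a ^ 3 / 2 + c ^ 3 / 2 - ((a + c) / 2) ^ 3 = 3 / 8 * (a + c) * (a - c)\<^sup>2\<close>.  The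
  factor \<open>a + c\<close> degenerates at 0, so the convexity is not uniform in the quadratic sense; but
  \<open>a + c \<ge> \<bar>a - c\<bar>\<close> leaves a cubic gain.\<close>

lemma psi_cost_midpoint:
  assumes "a \<ge> 0" "b \<ge> 0" "c \<ge> 0" "d \<ge> 0"
  shows "psi_cost a b / 2 + psi_cost c d / 2 - psi_cost ((a + c) / 2) ((b + d) / 2)
    \<ge> \<bar>a - c\<bar> ^ 3 / 4"
proof -
  have "psi_cost a b / 2 + psi_cost c d / 2 - psi_cost ((a + c) / 2) ((b + d) / 2)
      = 1 / 8 * (a + b + c + d) * ((a + b) - (c + d))\<^sup>2 + 1 / 4 * (a + c) * (a - c)\<^sup>2"
    by (simp add: psi_cost_def field_simps power2_eq_square power3_eq_cube)
  moreover have "1 / 8 * (a + b + c + d) * ((a + b) - (c + d))\<^sup>2 \<ge> 0"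
    using assms by simp
  moreover have "(a + c) * (a - c)\<^sup>2 \<ge> \<bar>a - c\<bar> * (a - c)\<^sup>2"
    using assms by (intro mult_right_mono) auto
  moreover have "\<bar>a - c\<bar> * (a - c)\<^sup>2 = \<bar>a - c\<bar> ^ 3"
    by (simp add: power3_eq_cube power2_eq_square mult.assoc)
  ultimately show ?thesis by linarith
qed

lemma b_cost_midpoint:
  assumes "a \<ge> 0" "c \<ge> 0"
  shows "b_cost a / 2 + b_cost c / 2 - b_cost ((a + c) / 2) \<ge> 0"
proof -
  have "b_cost a / 2 + b_cost c / 2 - b_cost ((a + c) / 2) = 1 / 8 * (a + c) * (a - c)\<^sup>2"
    by (simp add: b_cost_def field_simps power2_eq_square power3_eq_cube)
  moreover have "1 / 8 * (a + c) * (a - c)\<^sup>2 \<ge> 0" using assms by simp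
  ultimately show ?thesis by linarith
qed

lemma J_midpoint:
  assumes v: "v \<in> admissible" and w: "w \<in> admissible"
  shows "J_functional v / 2 + J_functional w / 2 - J_functional (midpoint_seq v w)
    \<ge> \<bar>v k - w k\<bar> ^ 3 / 4"
proof -
  note nonneg = admissible_nonneg[OF v] admissible_nonneg[OF w]
  let ?g = "\<lambda>j. psi_cost (v j) (v (Suc j)) / 2 + psi_cost (w j) (w (Suc j)) / 2
    - psi_cost ((v j + w j) / 2) ((v (Suc j) + w (Suc j)) / 2)"
  let ?G = "\<lambda>n. J_upto n v / 2 + J_upto n w / 2 - J_upto n (midpoint_seq v w)"
  have lim: "?G \<longlonglongrightarrow> J_functional v / 2 + J_functional w / 2 - J_functional (midpoint_seq v w)"
    by (intro tendsto_intros J_upto_tendsto midpoint_seq_admissible v w) simp_all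
  have g: "?g j \<ge> \<bar>v j - w j\<bar> ^ 3 / 4" for j
    by (rule psi_cost_midpoint) (rule nonneg)+
  have g0: "?g j \<ge> 0" for j
    using g[of j] zero_le_power_abs[of "v j - w j" 3] by linarith
  have "?G n \<ge> \<bar>v k - w k\<bar> ^ 3 / 4" if "n \<ge> Suc k" for n
  proof -
    have "\<bar>v k - w k\<bar> ^ 3 / 4 \<le> ?g k" by (rule g)
    also have "\<dots> \<le> (\<Sum>j<n. ?g j)"
      using that by (intro member_le_sum g0) auto
    also have "\<dots> \<le> b_cost (v 0) / 2 + b_cost (w 0) / 2 - b_cost ((v 0 + w 0) / 2) + (\<Sum>j<n. ?g j)"
      using b_cost_midpoint[OF nonneg, of 0 0] by simp
    also have "\<dots> = ?G n"
      unfolding J_upto_def midpoint_seq_def sum.distrib sum_subtractf sum_divide_distrib[symmetric]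
      by argo
    finally show ?thesis .
  qed
  then show ?thesis
    by (intro tendsto_lowerbound[OF lim]) (auto simp: eventually_sequentially intro!: exI[of _ "Suc k"])
qed

text \<open>Lower semicontinuity under pointwise convergence: finitely many terms pass to the limit,
  and truncation only lowers the functional.\<close>

lemma admissible_limit:
  assumes f: "\<And>n. f n \<in> admissible" and lim: "\<And>j. (\<lambda>n. f n j) \<longlonglongrightarrow> w j"
    and J: "(\<lambda>n. J_functional (f n)) \<longlonglongrightarrow> I"
  shows "w \<in> admissible" "J_functional w \<le> I"
proof -
  have nonneg: "w j \<ge> 0" for j
    using lim by (rule LIMSEQ_le_const) (auto intro: admissible_nonneg f)
  have le: "J_upto m w \<le> I" for m
  proof (rule LIMSEQ_le[OF _ J])
    show "(\<lambda>n. J_upto m (f n)) \<longlonglongrightarrow> J_upto m w"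
      unfolding J_upto_def b_cost_def psi_cost_def by (intro tendsto_intros lim) auto
    show "\<exists>N. \<forall>n\<ge>N. J_upto m (f n) \<le> J_functional (f n)"
      using J_upto_le[OF f] by blast
  qed
  have "summable (\<lambda>j. (w j - 1)\<^sup>2)"
  proof (rule summableI_nonneg_bounded)
    fix n
    have "(\<Sum>j<n. (w j - 1)\<^sup>2) \<le> (\<Sum>j<n. psi_cost (w j) (w (Suc j)))"
      by (intro sum_mono psi_cost_lower nonneg)
    also have "\<dots> \<le> I + 5 / 3"
      using le[of n] b_cost_lower[OF nonneg, of 0] by (simp add: J_upto_def)
    finally show "(\<Sum>j<n. (w j - 1)\<^sup>2) \<le> I + 5 / 3" .
  qed simp
  then show w: "w \<in> admissible"
    using nonneg by (simp add: admissible_def)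
  show "J_functional w \<le> I"
    using J_upto_tendsto[OF w] by (rule LIMSEQ_le_const2) (auto intro: le)
qed

text \<open>Along a minimizing sequence the midpoint gain is at most the distance of the two values
  from the infimum, so each coordinate is a Cauchy sequence.\<close>

lemma minimizer_exists:
  obtains w where "w \<in> admissible" "\<And>v. v \<in> admissible \<Longrightarrow> J_functional w \<le> J_functional v"
proof -
  define I where "I = Inf (J_functional ` admissible)"
  have ne: "(\<lambda>_. 1) \<in> admissible" by (simp add: admissible_def)
  have bdd: "bdd_below (J_functional ` admissible)"
    using J_functional_lower by (intro bdd_belowI[of _ "- 5 / 3"]) auto
  have I_le: "I \<le> J_functional v" if "v \<in> admissible" for v
    unfolding I_def using that bdd by (intro cInf_lower) auto
  have "\<exists>v\<in>admissible. J_functional v < I + 1 / real (Suc n)" for n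
    using cInf_lessD[of "J_functional ` admissible" "I + 1 / real (Suc n)"] ne
    by (auto simp: I_def)
  then obtain f where f: "\<And>n. f n \<in> admissible"
    and fI: "\<And>n. J_functional (f n) < I + 1 / real (Suc n)"
    by metis
  have gap: "\<bar>f m j - f n j\<bar> ^ 3 \<le> 4 / real (Suc N)" if "m \<ge> N" "n \<ge> N" for m n N j
  proof -
    have "1 / real (Suc m) \<le> 1 / real (Suc N)" "1 / real (Suc n) \<le> 1 / real (Suc N)"
      using that by (auto intro!: divide_left_mono)
    then have "J_functional (f m) / 2 + J_functional (f n) / 2 \<le> I + 1 / real (Suc N)"
      using fI[of m] fI[of n] by linarith
    then show ?thesis
      using J_midpoint[OF f[of m] f[of n], of j]
        I_le[OF midpoint_seq_admissible[OF f[of m] f[of n]]]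
      by linarith
  qed
  have "Cauchy (\<lambda>n. f n j)" for j
  proof (rule metric_CauchyI)
    fix e :: real assume "e > 0"
    then obtain N where N: "inverse (real (Suc N)) < e ^ 3 / 4"
      using reals_Archimedean[of "e ^ 3 / 4"] by auto
    have "dist (f m j) (f n j) < e" if "m \<ge> N" "n \<ge> N" for m n
    proof -
      have "\<bar>f m j - f n j\<bar> ^ 3 < e ^ 3"
        using gap[OF that, of j] N by (simp add: inverse_eq_divide)
      then show ?thesis
        using \<open>e > 0\<close> by (simp add: dist_real_def power_less_imp_less_base)
    qed
    then show "\<exists>N. \<forall>m\<ge>N. \<forall>n\<ge>N. dist (f m j) (f n j) < e" by blast
  qed
  then obtain w where lim: "\<And>j. (\<lambda>n. f n j) \<longlonglongrightarrow> w j"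
    unfolding Cauchy_convergent_iff convergent_def by metis
  have "(\<lambda>n. J_functional (f n)) \<longlonglongrightarrow> I"
  proof (rule tendsto_sandwich[OF _ _ tendsto_const])
    show "(\<lambda>n. I + 1 / real (Suc n)) \<longlonglongrightarrow> I"
      using tendsto_add[OF tendsto_const LIMSEQ_Suc[OF lim_1_over_n], of I] by simp
  qed (use I_le[OF f] fI in \<open>auto intro!: always_eventually less_imp_le\<close>)
  from admissible_limit[OF f lim this] I_le that show ?thesis
    by (meson order_trans)
qed

section \<open>Minimizers are positive solutions\<close>

text \<open>The part of the functional that involves the coordinate \<open>x\<close> with neighbours \<open>p\<close> and \<open>q\<close>, up to
  a constant.  With \<open>p = 0\<close> the term \<open>(p + x) ^ 3 / 3\<close> is the cubic part of \<^const>\<open>b_cost\<close>, so this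
  also covers the first coordinate.\<close>

definition coordinate_cost :: "real \<Rightarrow> real \<Rightarrow> real \<Rightarrow> real" where
  "coordinate_cost p q x = (p + x) ^ 3 / 3 + (x + q) ^ 3 / 3 + 2 * x ^ 3 / 3 - 10 * x"

lemma coordinate_cost_deriv:
  "(coordinate_cost p q has_real_derivative (p + x)\<^sup>2 + (x + q)\<^sup>2 + 2 * x\<^sup>2 - 10) (at x)"
  unfolding coordinate_cost_def
  by (auto intro!: derivative_eq_intros simp: field_simps)

lemma J_upto_update:
  assumes "n \<ge> Suc k"
  shows "J_upto n (w(k := x)) - J_upto n w
    = coordinate_cost (prev w k) (w (Suc k)) x - coordinate_cost (prev w k) (w (Suc k)) (w k)"
  using assms
proof (induction n rule: dec_induct)
  case base
  show ?case
  proof (cases k)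
    case 0
    then show ?thesis
      by (simp add: J_upto_def b_cost_def psi_cost_def coordinate_cost_def field_simps)
  next
    case (Suc i)
    have "(\<Sum>j<i. psi_cost ((w(k := x)) j) ((w(k := x)) (Suc j)))
        = (\<Sum>j<i. psi_cost (w j) (w (Suc j)))"
      using Suc by (intro sum.cong) auto
    with Suc show ?thesis
      by (simp add: J_upto_def psi_cost_def coordinate_cost_def field_simps)
  qed
next
  case (step n)
  then show ?case by (simp add: J_upto_def)
qed

lemma update_admissible:
  assumes w: "w \<in> admissible" and "x \<ge> 0"
  shows "w(k := x) \<in> admissible"
proof -
  have "summable (\<lambda>j. ((w(k := x)) j - 1)\<^sup>2) \<longleftrightarrow> summable (\<lambda>j. (w j - 1)\<^sup>2)"
    by (rule summable_cong) (use eventually_gt_at_top[of k] in eventually_elim, simp)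
  then show ?thesis
    using assms by (auto simp: admissible_def)
qed

lemma minimizer_coordinate:
  assumes w: "w \<in> admissible" and min: "\<And>v. v \<in> admissible \<Longrightarrow> J_functional w \<le> J_functional v"
    and "x \<ge> 0"
  shows "coordinate_cost (prev w k) (w (Suc k)) (w k) \<le> coordinate_cost (prev w k) (w (Suc k)) x"
proof -
  note w' = update_admissible[OF w \<open>x \<ge> 0\<close>, of k]
  have "(\<lambda>n. J_upto n (w(k := x)) - J_upto n w)
      \<longlonglongrightarrow> J_functional (w(k := x)) - J_functional w"
    by (intro tendsto_diff J_upto_tendsto w w')
  moreover have "(\<lambda>n. J_upto n (w(k := x)) - J_upto n w) \<longlonglongrightarrow>
      coordinate_cost (prev w k) (w (Suc k)) x - coordinate_cost (prev w k) (w (Suc k)) (w k)"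
    by (rule tendsto_eventually)
      (auto simp: eventually_sequentially J_upto_update intro!: exI[of _ "Suc k"])
  ultimately show ?thesis
    using LIMSEQ_unique min[OF w'] by fastforce
qed

text \<open>A zero coordinate is excluded by a quantitative argument: two neighbours with squares at
  most \<open>5 / 2\<close> cannot balance the 10 in the derivative at 0.\<close>

lemma minimizer_positive_solution:
  assumes w: "w \<in> admissible" and min: "\<And>v. v \<in> admissible \<Longrightarrow> J_functional w \<le> J_functional v"
  shows "positive_solution w"
proof -
  note nonneg = admissible_nonneg[OF w]
  have prev_nonneg: "prev w k \<ge> 0" for k
    using nonneg by (cases k) auto
  have st: "stationary w k" if "w k > 0" for k
  proof -
    have "(prev w k + w k)\<^sup>2 + (w k + w (Suc k))\<^sup>2 + 2 * (w k)\<^sup>2 - 10 = 0"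
      by (rule DERIV_local_min[OF coordinate_cost_deriv that])
        (auto intro!: minimizer_coordinate[OF w min])
    then show ?thesis by (simp add: stationary_def)
  qed
  have small: "(w k)\<^sup>2 \<le> 5 / 2" for k
  proof (cases "w k = 0")
    case False
    then have "stationary w k" using nonneg[of k] by (intro st) simp
    moreover have "(prev w k + w k)\<^sup>2 \<ge> (w k)\<^sup>2" "(w k + w (Suc k))\<^sup>2 \<ge> (w k)\<^sup>2"
      using nonneg prev_nonneg by (auto intro!: power_mono)
    ultimately show ?thesis unfolding stationary_def by linarith
  qed simp
  have prev_small: "(prev w k)\<^sup>2 \<le> 5 / 2" for k
    using small by (cases k) auto
  have pos: "w k > 0" for k
  proof (rule ccontr)
    assume "\<not> w k > 0"
    then have 0: "w k = 0" using nonneg[of k] by simp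
    have "(prev w k + 0)\<^sup>2 + (0 + w (Suc k))\<^sup>2 + 2 * 0\<^sup>2 - 10 < 0"
      using prev_small[of k] small[of "Suc k"] by simp
    from DERIV_neg_dec_right[OF coordinate_cost_deriv this] obtain d where "d > 0"
      and d: "\<And>h. h > 0 \<Longrightarrow> h < d \<Longrightarrow>
        coordinate_cost (prev w k) (w (Suc k)) (0 + h) < coordinate_cost (prev w k) (w (Suc k)) 0"
      by auto
    show False
      using d[of "d / 2"] \<open>d > 0\<close> minimizer_coordinate[OF w min, of "d / 2" k] 0 by simp
  qed
  show ?thesis
    using pos st admissible_tendsto[OF w] by (auto simp: positive_solution_iff)
qed

section \<open>Decay of solutions tending to 1\<close>

text \<open>The equation for \<open>w = 1 + u\<close> divided by 4, with its quadratic terms collected on the right.\<close>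

definition quad_rem :: "(nat \<Rightarrow> real) \<Rightarrow> nat \<Rightarrow> real" where
  "quad_rem u j = - ((u j + u (j + 1))\<^sup>2 + (u (j + 1) + u (j + 2))\<^sup>2 + 2 * (u (j + 1))\<^sup>2) / 4"

definition perturbed_recurrence :: "(nat \<Rightarrow> real) \<Rightarrow> bool" where
  "perturbed_recurrence u \<longleftrightarrow> (\<forall>j. u j + 3 * u (j + 1) + u (j + 2) = quad_rem u j)"

lemma stationary_imp_perturbed_recurrence:
  assumes "\<And>k. stationary w k"
  shows "perturbed_recurrence (\<lambda>j. w (N + j) - 1)"
  unfolding perturbed_recurrence_def
proof
  fix j
  show "(w (N + j) - 1) + 3 * (w (N + (j + 1)) - 1) + (w (N + (j + 2)) - 1)
      = quad_rem (\<lambda>j. w (N + j) - 1) j"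
    using assms[of "Suc (N + j)"]
    by (simp add: stationary_def quad_rem_def field_simps power2_eq_square)
qed

lemma quad_rem_bound: "\<bar>quad_rem u j\<bar> \<le> ((u j)\<^sup>2 + 3 * (u (j + 1))\<^sup>2 + (u (j + 2))\<^sup>2) / 2"
proof -
  have s: "(x + y)\<^sup>2 \<le> 2 * x\<^sup>2 + 2 * y\<^sup>2" for x y :: real
    using zero_le_power2[of "x - y"] by (simp add: power2_sum power2_diff)
  show ?thesis
    unfolding quad_rem_def
    using s[of "u j" "u (j + 1)"] s[of "u (j + 1)" "u (j + 2)"]
      zero_le_power2[of "u j + u (j + 1)"] zero_le_power2[of "u (j + 1) + u (j + 2)"]
      zero_le_power2[of "u (j + 1)"]
    unfolding abs_le_iff by (intro conjI; argo)
qed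

text \<open>The numbers 2 and \<open>1 / 2\<close> are the roots of \<open>x\<^sup>2 - 5 / 2 * x + 1\<close>, so a sequence violating the
  conclusion once has \<open>a (j + 1) - a j / 2\<close> at least doubling from there on, which is
  incompatible with the limit 0.\<close>

lemma subconvex_null_halves:
  fixes a :: "nat \<Rightarrow> real"
  assumes sub: "\<And>j. 5 / 2 * a (j + 1) \<le> a j + a (j + 2)" and lim: "a \<longlonglongrightarrow> 0"
  shows "a (j + 1) \<le> a j / 2"
proof (rule ccontr)
  define e where "e j = a (j + 1) - a j / 2" for j
  assume "\<not> a (j + 1) \<le> a j / 2"
  then have pos: "e j > 0" by (simp add: e_def)
  have step: "e (k + 1) \<ge> 2 * e k" for k
    using sub[of k] by (simp add: e_def)
  have ge: "e (j + n) \<ge> e j" for n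
  proof (induction n)
    case (Suc n)
    then show ?case using step[of "j + n"] pos by simp
  qed simp
  have "e \<longlonglongrightarrow> 0 - 0 / 2"
    unfolding e_def Suc_eq_plus1[symmetric] by (intro tendsto_intros LIMSEQ_Suc lim) simp
  then have "(\<lambda>n. e (n + j)) \<longlonglongrightarrow> 0"
    by (intro LIMSEQ_ignore_initial_segment) simp
  then have "e j \<le> 0"
    by (rule LIMSEQ_le_const) (use ge in \<open>auto simp: add.commute\<close>)
  with pos show False by simp
qed

text \<open>The bound \<open>1 / 10\<close> is small enough for the quadratic remainder to leave room between the
  linear coefficient 3 and the \<open>5 / 2\<close> of \<open>subconvex_null_halves\<close>, and for the factor 4 below.\<close>

context
  fixes u :: "nat \<Rightarrow> real"
  assumes rec: "perturbed_recurrence u" and lim: "u \<longlonglongrightarrow> 0" and small: "\<And>j. \<bar>u j\<bar> \<le> 1 / 10"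
begin

lemma quad_rem_small: "\<bar>quad_rem u j\<bar> \<le> (\<bar>u j\<bar> + 3 * \<bar>u (j + 1)\<bar> + \<bar>u (j + 2)\<bar>) / 20"
proof -
  have sq: "(u k)\<^sup>2 \<le> \<bar>u k\<bar> / 10" for k
    using mult_left_mono[OF small[of k], of "\<bar>u k\<bar>"] by (simp add: power2_eq_square flip: abs_mult)
  show ?thesis
    using quad_rem_bound[of u j] sq[of j] sq[of "j + 1"] sq[of "j + 2"] by argo
qed

lemma recurrence_eq: "u j + 3 * u (j + 1) + u (j + 2) = quad_rem u j"
  using rec by (simp add: perturbed_recurrence_def)

lemma recurrence_abs_halves: "\<bar>u (j + 1)\<bar> \<le> \<bar>u j\<bar> / 2"
proof (rule subconvex_null_halves[of "\<lambda>j. \<bar>u j\<bar>"])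
  fix j
  show "5 / 2 * \<bar>u (j + 1)\<bar> \<le> \<bar>u j\<bar> + \<bar>u (j + 2)\<bar>"
  proof -
    have "3 * \<bar>u (j + 1)\<bar> \<le> \<bar>u j\<bar> + \<bar>u (j + 2)\<bar> + \<bar>quad_rem u j\<bar>"
      using recurrence_eq[of j] by linarith
    then show ?thesis
      using quad_rem_small[of j] abs_ge_zero[of "u (j + 1)"] by argo
  qed
qed (use lim in \<open>simp add: tendsto_rabs_zero_iff\<close>)

text \<open>Solving the recurrence backwards bounds the decay from below; this later forces the leading
  coefficient of the expansion to be nonzero.\<close>

lemma recurrence_abs_le_4_times: "\<bar>u j\<bar> \<le> 4 * \<bar>u (j + 1)\<bar>"
proof -
  have "\<bar>u j\<bar> \<le> 3 * \<bar>u (j + 1)\<bar> + \<bar>u (j + 2)\<bar> + \<bar>quad_rem u j\<bar>"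
    using recurrence_eq[of j] by linarith
  moreover have "\<bar>u (j + 2)\<bar> \<le> \<bar>u (j + 1)\<bar> / 2"
    using recurrence_abs_halves[of "j + 1"] by simp
  ultimately show ?thesis
    using quad_rem_small[of j] abs_ge_zero[of "u (j + 1)"] by argo
qed

lemma recurrence_abs_upper: "\<bar>u j\<bar> \<le> (1 / 2) ^ j"
proof (induction j)
  case 0
  show ?case using small[of 0] by simp
next
  case (Suc j)
  then show ?case using recurrence_abs_halves[of j] by simp
qed

lemma recurrence_abs_lower: "\<bar>u 0\<bar> \<le> 4 ^ j * \<bar>u j\<bar>"
proof (induction j)
  case (Suc j)
  have "4 ^ j * \<bar>u j\<bar> \<le> 4 ^ j * (4 * \<bar>u (j + 1)\<bar>)"
    by (intro mult_left_mono recurrence_abs_le_4_times) simp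
  with Suc have "\<bar>u 0\<bar> \<le> 4 ^ j * (4 * \<bar>u (j + 1)\<bar>)" by linarith
  then show ?case by (simp add: mult_ac)
qed simp

end

lemma positive_solution_small_tail:
  assumes "positive_solution w"
  obtains N where "\<And>j. \<bar>w (N + j) - 1\<bar> \<le> 1 / 10" "(\<lambda>j. w (N + j) - 1) \<longlonglongrightarrow> 0"
    "perturbed_recurrence (\<lambda>j. w (N + j) - 1)"
proof -
  have lim: "w \<longlonglongrightarrow> 1" and st: "\<And>k. stationary w k"
    using assms by (auto simp: positive_solution_iff)
  obtain N where N: "\<And>n. n \<ge> N \<Longrightarrow> \<bar>w n - 1\<bar> < 1 / 10"
    using LIMSEQ_D[OF lim, of "1 / 10"] by auto
  have "(\<lambda>j. w (j + N) - 1) \<longlonglongrightarrow> 0"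
    using LIMSEQ_ignore_initial_segment[OF lim, of N] by (rule LIM_zero)
  then show ?thesis
    using that[of N] N stationary_imp_perturbed_recurrence[OF st, of N]
    by (simp add: add.commute less_imp_le)
qed

lemma positive_solution_admissible:
  assumes "positive_solution w"
  shows "w \<in> admissible"
proof -
  obtain N where N: "\<And>j. \<bar>w (N + j) - 1\<bar> \<le> 1 / 10" "(\<lambda>j. w (N + j) - 1) \<longlonglongrightarrow> 0"
    "perturbed_recurrence (\<lambda>j. w (N + j) - 1)"
    using positive_solution_small_tail[OF assms] by blast
  have "norm ((w (j + N) - 1)\<^sup>2) \<le> (1 / 4) ^ j" for j
  proof -
    have "\<bar>w (N + j) - 1\<bar>\<^sup>2 \<le> ((1 / 2) ^ j)\<^sup>2"
      by (intro power_mono recurrence_abs_upper[OF N(3,2,1)]) simp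
    also have "\<dots> = ((1 / 2)\<^sup>2) ^ j"
      by (simp only: power_mult[symmetric] mult.commute)
    also have "(1 / 2 :: real)\<^sup>2 = 1 / 4"
      by (simp add: power2_eq_square)
    finally show ?thesis by (simp add: add.commute)
  qed
  then have "summable (\<lambda>j. (w (j + N) - 1)\<^sup>2)"
    by (rule summable_comparison_test'[where g = "\<lambda>j. (1 / 4) ^ j" and N = 0, rotated]) simp
  then have "summable (\<lambda>j. (w j - 1)\<^sup>2)"
    by (simp only: summable_iff_shift[of "\<lambda>j. (w j - 1)\<^sup>2"])
  then show ?thesis
    using assms by (auto simp: admissible_def positive_solution_def less_imp_le)
qed

section \<open>The exact rate\<close>

lemma lambda_s_root: "lambda_s\<^sup>2 + 3 * lambda_s + 1 = 0"
  by (simp add: lambda_s_def power2_eq_square field_simps)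

lemma lambda_s_bounds: "\<bar>lambda_s\<bar> > 1 / 4" "\<bar>lambda_s\<bar> < 1 / 2"
proof -
  have "2 < sqrt 5"
    by (rule real_less_rsqrt) simp
  moreover have "sqrt 5 < 5 / 2"
    by (rule real_less_lsqrt) (simp_all add: power2_eq_square)
  ultimately show "\<bar>lambda_s\<bar> > 1 / 4" "\<bar>lambda_s\<bar> < 1 / 2"
    by (auto simp: lambda_s_def)
qed

text \<open>The expanding direction of the recurrence, read backwards, contracts.  A null sequence has no
  homogeneous part in that direction, so it is controlled by the forcing alone: the excess
  \<open>\<bar>v j\<bar> - R * \<rho> ^ j\<close> is at most \<open>\<bar>l\<bar> ^ n\<close> times the excess at \<open>j + n\<close>, hence nonpositive.\<close>

lemma backward_contraction_bound:
  fixes v r :: "nat \<Rightarrow> real"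
  assumes v: "\<And>j. v j = l * (v (j + 1) - r j)" and r: "\<And>j. \<bar>r j\<bar> \<le> R * \<rho> ^ j"
    and l: "\<bar>l\<bar> \<le> 1 / 2" and \<rho>: "0 \<le> \<rho>" "\<rho> < 1" and lim: "v \<longlonglongrightarrow> 0"
  shows "\<bar>v j\<bar> \<le> R * \<rho> ^ j"
proof -
  have R: "R \<ge> 0" using r[of 0] by simp
  define s where "s j = \<bar>v j\<bar> - R * \<rho> ^ j" for j
  have step: "s j \<le> \<bar>l\<bar> * s (j + 1)" for j
  proof -
    have "\<bar>v j\<bar> \<le> \<bar>l\<bar> * (\<bar>v (j + 1)\<bar> + R * \<rho> ^ j)"
      unfolding v[of j] abs_mult using r[of j] by (intro mult_left_mono) auto
    moreover have "\<bar>l\<bar> * (R * \<rho> ^ (j + 1) + R * \<rho> ^ j) \<le> 1 / 2 * (R * \<rho> ^ j + R * \<rho> ^ j)"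
      using R \<rho> l by (intro mult_mono add_mono mult_left_mono power_decreasing) auto
    ultimately show ?thesis by (simp add: s_def algebra_simps)
  qed
  have iter: "s j \<le> \<bar>l\<bar> ^ n * s (j + n)" for n
  proof (induction n)
    case (Suc n)
    have "\<bar>l\<bar> ^ n * s (j + n) \<le> \<bar>l\<bar> ^ n * (\<bar>l\<bar> * s (j + n + 1))"
      by (intro mult_left_mono step) simp
    with Suc show ?case by (simp add: algebra_simps)
  qed simp
  have "s \<longlonglongrightarrow> \<bar>0\<bar> - R * 0"
    unfolding s_def using \<rho> by (intro tendsto_intros lim LIMSEQ_power_zero) auto
  then have "(\<lambda>n. s (n + j)) \<longlonglongrightarrow> 0"
    by (intro LIMSEQ_ignore_initial_segment) simp
  moreover have "(\<lambda>n. \<bar>l\<bar> ^ n) \<longlonglongrightarrow> 0"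
    using l by (intro LIMSEQ_power_zero) auto
  ultimately have "(\<lambda>n. \<bar>l\<bar> ^ n * s (n + j)) \<longlonglongrightarrow> 0 * 0"
    by (intro tendsto_mult)
  then have "s j \<le> 0 * 0"
    by (rule LIMSEQ_le_const) (use iter in \<open>auto simp: add.commute\<close>)
  then show ?thesis by (simp add: s_def)
qed

lemma geometric_increments_converge:
  fixes z :: "nat \<Rightarrow> real"
  assumes z: "\<And>j. \<bar>z (j + 1) - z j\<bar> \<le> K * q ^ j" and q: "0 \<le> q" "q < 1"
  obtains c where "\<And>j. \<bar>z j - c\<bar> \<le> K / (1 - q) * q ^ j"
proof -
  have geo: "(\<lambda>i. K * q ^ j * q ^ i) sums (K * q ^ j * (1 / (1 - q)))" for j
    using q by (intro sums_mult geometric_sums) auto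
  have b: "norm (z (Suc (i + j)) - z (i + j)) \<le> K * q ^ j * q ^ i" for i j
    using z[of "i + j"] by (simp add: power_add mult_ac)
  have sm: "summable (\<lambda>i. z (Suc (i + j)) - z (i + j))" for j
    by (rule summable_comparison_test'[OF sums_summable[OF geo[of j]], of 0]) (rule b)
  define c where "c = z 0 + (\<Sum>i. z (Suc i) - z i)"
  have "(\<lambda>i. z (Suc i) - z i) sums (c - z 0)"
    using summable_sums[OF sm[of 0]] by (simp add: c_def)
  then have "(\<lambda>n. (\<Sum>i<n. z (Suc i) - z i) + z 0) \<longlonglongrightarrow> (c - z 0) + z 0"
    unfolding sums_def by (intro tendsto_add tendsto_const)
  then have lim: "z \<longlonglongrightarrow> c"
    by (simp add: sum_lessThan_telescope)
  have "\<bar>z j - c\<bar> \<le> K / (1 - q) * q ^ j" for j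
  proof -
    have "(\<lambda>i. z (i + j)) \<longlonglongrightarrow> c"
      using lim by (rule LIMSEQ_ignore_initial_segment)
    from telescope_sums[OF this]
    have "(\<lambda>i. z (Suc (i + j)) - z (i + j)) sums (c - z j)"
      by simp
    then have "c - z j = (\<Sum>i. z (Suc (i + j)) - z (i + j))"
      by (rule sums_unique)
    moreover have "norm (\<Sum>i. z (Suc (i + j)) - z (i + j)) \<le> (\<Sum>i. K * q ^ j * q ^ i)"
      by (rule norm_suminf_le[OF b sums_summable[OF geo]])
    moreover have "(\<Sum>i. K * q ^ j * q ^ i) = K * q ^ j * (1 / (1 - q))"
      using geo[of j] by (rule sums_unique[symmetric])
    ultimately have "\<bar>c - z j\<bar> \<le> K * q ^ j * (1 / (1 - q))"
      by simp
    then show ?thesis by (simp add: abs_minus_commute mult_ac)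
  qed
  then show ?thesis by (rule that)
qed

text \<open>The characteristic polynomial factors, with \<open>lambda_s\<close> and \<open>1 / lambda_s\<close> as roots.
  Removing the contracting root leaves \<open>v j = u (j + 1) - lambda_s * u j\<close>, governed by the
  expanding root and thus as small as the forcing.  The quotients \<open>u j / lambda_s ^ j\<close> then have
  geometrically small increments, and their limit is the coefficient.\<close>

lemma linear_recurrence_asymptotics:
  assumes rec: "\<And>j. u j + 3 * u (j + 1) + u (j + 2) = r j" and lim: "u \<longlonglongrightarrow> 0"
    and r: "\<And>j. \<bar>r j\<bar> \<le> R * \<rho> ^ j" and \<rho>: "0 \<le> \<rho>" "\<rho> < \<bar>lambda_s\<bar>"
  obtains c K where "\<And>j. \<bar>u j - c * lambda_s ^ j\<bar> \<le> K * \<rho> ^ j"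
proof -
  let ?l = lambda_s
  have l: "?l \<noteq> 0" "\<bar>?l\<bar> > 0" using lambda_s_bounds by auto
  define v where "v j = u (j + 1) - ?l * u j" for j
  have v_rec: "v j = ?l * (v (j + 1) - r j)" for j
  proof -
    have "v (j + 1) - r j = - (?l + 3) * u (j + 1) - u j"
      unfolding rec[of j, symmetric] by (simp add: v_def algebra_simps)
    then have "?l * (v (j + 1) - r j) = ?l * (- (?l + 3) * u (j + 1) - u j)"
      by (rule arg_cong)
    also have "\<dots> = - (?l\<^sup>2 + 3 * ?l) * u (j + 1) - ?l * u j"
      by (simp add: algebra_simps power2_eq_square)
    also have "?l\<^sup>2 + 3 * ?l = - 1" using lambda_s_root by simp
    finally show ?thesis by (simp add: v_def)
  qed
  have "v \<longlonglongrightarrow> 0 - ?l * 0"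
    unfolding v_def Suc_eq_plus1[symmetric] by (intro tendsto_intros LIMSEQ_Suc lim)
  then have "v \<longlonglongrightarrow> 0" by simp
  then have v_bound: "\<bar>v j\<bar> \<le> R * \<rho> ^ j" for j
    using \<rho> lambda_s_bounds by (intro backward_contraction_bound[OF v_rec r]) auto
  define z where "z j = u j / ?l ^ j" for j
  have "\<bar>z (j + 1) - z j\<bar> \<le> (R / \<bar>?l\<bar>) * (\<rho> / \<bar>?l\<bar>) ^ j" for j
  proof -
    have "z (j + 1) - z j = v j / ?l ^ (j + 1)"
      using l by (simp add: z_def v_def field_simps)
    then have "\<bar>z (j + 1) - z j\<bar> = \<bar>v j\<bar> / \<bar>?l\<bar> ^ (j + 1)"
      by (simp add: abs_divide power_abs abs_mult)
    also have "\<dots> \<le> (R * \<rho> ^ j) / \<bar>?l\<bar> ^ (j + 1)"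
      by (intro divide_right_mono v_bound) simp
    finally show ?thesis by (simp add: power_divide)
  qed
  then obtain c where c: "\<And>j. \<bar>z j - c\<bar> \<le> (R / \<bar>?l\<bar>) / (1 - \<rho> / \<bar>?l\<bar>) * (\<rho> / \<bar>?l\<bar>) ^ j"
    using \<rho> l by (elim geometric_increments_converge) auto
  have "\<bar>u j - c * ?l ^ j\<bar> \<le> (R / \<bar>?l\<bar>) / (1 - \<rho> / \<bar>?l\<bar>) * \<rho> ^ j" for j
  proof -
    have "u j - c * ?l ^ j = (z j - c) * ?l ^ j"
      using l by (simp add: z_def algebra_simps)
    then have "\<bar>u j - c * ?l ^ j\<bar> = \<bar>z j - c\<bar> * \<bar>?l\<bar> ^ j"
      by (simp add: abs_mult power_abs)
    also have "\<dots> \<le> ((R / \<bar>?l\<bar>) / (1 - \<rho> / \<bar>?l\<bar>) * (\<rho> / \<bar>?l\<bar>) ^ j) * \<bar>?l\<bar> ^ j"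
      by (intro mult_right_mono c) simp
    also have "\<dots> = (R / \<bar>?l\<bar>) / (1 - \<rho> / \<bar>?l\<bar>) * \<rho> ^ j"
      using l by (simp add: power_divide)
    finally show ?thesis .
  qed
  then show ?thesis by (rule that)
qed

lemma quad_rem_geometric:
  assumes u: "\<And>j. \<bar>u j\<bar> \<le> K * q ^ j" and q: "0 \<le> q" "q \<le> 1"
  shows "\<bar>quad_rem u j\<bar> \<le> (5 / 2 * K\<^sup>2) * (q\<^sup>2) ^ j"
proof -
  have K: "K \<ge> 0" using u[of 0] by simp
  have sq: "(u i)\<^sup>2 \<le> K\<^sup>2 * (q\<^sup>2) ^ j" if "i \<ge> j" for i
  proof -
    have "\<bar>u i\<bar> \<le> K * q ^ j"
      using u[of i] mult_left_mono[OF power_decreasing[OF that q] K] by linarith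
    then have "\<bar>u i\<bar>\<^sup>2 \<le> (K * q ^ j)\<^sup>2"
      by (intro power_mono) auto
    then show ?thesis
      by (simp add: power_mult_distrib power_mult[symmetric] mult.commute)
  qed
  show ?thesis
    using quad_rem_bound[of u j] sq[of j] sq[of "j + 1"] sq[of "j + 2"] by simp
qed

text \<open>Two rounds of \<open>linear_recurrence_asymptotics\<close>.  The a priori rate \<open>1 / 2\<close> suffices to start,
  because its square lies below \<open>\<bar>lambda_s\<bar>\<close>; the second round starts from the sharp rate.\<close>

lemma perturbed_recurrence_asymptotics:
  assumes rec: "perturbed_recurrence u" and lim: "u \<longlonglongrightarrow> 0" and small: "\<And>j. \<bar>u j\<bar> \<le> 1 / 10"
    and nz: "u 0 \<noteq> 0"
  obtains c K where "c \<noteq> 0" "\<And>j. \<bar>u j - c * lambda_s ^ j\<bar> \<le> K * (\<bar>lambda_s\<bar>\<^sup>2) ^ j"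
proof -
  let ?l = lambda_s
  note eq = recurrence_eq[OF rec lim small]
  have "\<bar>u j\<bar> \<le> 1 * (1 / 2) ^ j" for j
    using recurrence_abs_upper[OF rec lim small] by simp
  from quad_rem_geometric[OF this] have "\<bar>quad_rem u j\<bar> \<le> (5 / 2 * 1\<^sup>2) * ((1 / 2)\<^sup>2) ^ j" for j
    by simp
  from linear_recurrence_asymptotics[OF eq lim this] obtain c0 K0
    where c0: "\<And>j. \<bar>u j - c0 * ?l ^ j\<bar> \<le> K0 * ((1 / 2)\<^sup>2) ^ j"
    using lambda_s_bounds by (auto simp: power2_eq_square)
  have K0: "K0 \<ge> 0" using c0[of 0] by simp
  have "\<bar>u j\<bar> \<le> (K0 + \<bar>c0\<bar>) * \<bar>?l\<bar> ^ j" for j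
  proof -
    have "((1 / 2 :: real)\<^sup>2) ^ j \<le> \<bar>?l\<bar> ^ j"
      using lambda_s_bounds by (intro power_mono) (auto simp: power2_eq_square)
    then have "K0 * ((1 / 2)\<^sup>2) ^ j \<le> K0 * \<bar>?l\<bar> ^ j"
      using K0 by (rule mult_left_mono)
    moreover have "\<bar>c0 * ?l ^ j\<bar> = \<bar>c0\<bar> * \<bar>?l\<bar> ^ j"
      by (simp add: abs_mult power_abs)
    ultimately show ?thesis
      using c0[of j] unfolding distrib_right by linarith
  qed
  from quad_rem_geometric[OF this]
  have "\<bar>quad_rem u j\<bar> \<le> (5 / 2 * (K0 + \<bar>c0\<bar>)\<^sup>2) * (\<bar>?l\<bar>\<^sup>2) ^ j" for j
    using lambda_s_bounds by simp
  moreover have "\<bar>?l\<bar>\<^sup>2 < \<bar>?l\<bar>"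
  proof -
    have "\<bar>?l\<bar> * \<bar>?l\<bar> < 1 * \<bar>?l\<bar>"
      using lambda_s_bounds by (intro mult_strict_right_mono) linarith+
    then show ?thesis by (simp only: power2_eq_square mult_1)
  qed
  ultimately obtain c K where c: "\<And>j. \<bar>u j - c * ?l ^ j\<bar> \<le> K * (\<bar>?l\<bar>\<^sup>2) ^ j"
    using linear_recurrence_asymptotics[OF eq lim] by (metis zero_le_power2)
  \<comment> \<open>Otherwise \<open>u\<close> decays like \<open>\<bar>lambda_s\<bar> ^ (2 * j)\<close> but not faster than \<open>4^-j\<close>, and
    \<open>4 * lambda_s\<^sup>2 < 1\<close>.\<close>
  have "c \<noteq> 0"
  proof
    assume "c = 0"
    have le: "\<bar>u 0\<bar> \<le> K * (4 * \<bar>?l\<bar>\<^sup>2) ^ j" for j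
    proof -
      have "\<bar>u 0\<bar> \<le> 4 ^ j * \<bar>u j\<bar>" by (rule recurrence_abs_lower[OF rec lim small])
      also have "\<dots> \<le> 4 ^ j * (K * (\<bar>?l\<bar>\<^sup>2) ^ j)"
        using c[of j] \<open>c = 0\<close> by simp
      finally show ?thesis by (simp only: power_mult_distrib mult_ac)
    qed
    have "\<bar>?l\<bar>\<^sup>2 < (1 / 2)\<^sup>2"
      using lambda_s_bounds by (intro power_strict_mono) auto
    then have "(\<lambda>j. (4 * \<bar>?l\<bar>\<^sup>2) ^ j) \<longlonglongrightarrow> 0"
      by (intro LIMSEQ_power_zero) (simp add: power2_eq_square)
    then have "(\<lambda>j. K * (4 * \<bar>?l\<bar>\<^sup>2) ^ j) \<longlonglongrightarrow> K * 0"
      by (intro tendsto_mult tendsto_const)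
    then have "\<bar>u 0\<bar> \<le> K * 0"
      by (rule LIMSEQ_le_const) (use le in auto)
    with nz show False by simp
  qed
  with c show ?thesis by (rule that[rotated])
qed

text \<open>Among positive sequences the recurrence can be run backwards, so two consecutive values 1
  would propagate down to \<open>w 0 = w 1 = 1\<close>, contradicting the boundary equation.\<close>

lemma stationary_not_eventually_one:
  assumes st: "\<And>k. stationary w k" and pos: "\<And>k. w k > 0"
  shows "\<not> (w N = 1 \<and> w (Suc N) = 1)"
proof (induction N)
  case 0
  show ?case using st[of 0] by (auto simp: stationary_def)
next
  case (Suc N)
  show ?case
  proof
    assume a: "w (Suc N) = 1 \<and> w (Suc (Suc N)) = 1"
    then have "(w N + 1)\<^sup>2 = 2\<^sup>2"
      using st[of "Suc N"] by (simp add: stationary_def)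
    then have "w N = 1"
      using pos[of N] unfolding power2_eq_iff by linarith
    with a Suc show False by simp
  qed
qed

text \<open>The expansion is found on a tail on which \<open>w - 1\<close> is small.  That tail starts with a nonzero
  term: a zero there would make the next term zero as well.\<close>

lemma positive_solution_asymptotics:
  assumes "positive_solution w"
  shows "\<exists>c::real. c \<noteq> 0 \<and> (\<lambda>j. w j - 1 - c * lambda_s ^ j) \<in> O(\<lambda>j. \<bar>lambda_s\<bar> ^ (2 * j))"
proof -
  let ?l = lambda_s
  have l: "?l \<noteq> 0" using lambda_s_bounds by auto
  have st: "\<And>k. stationary w k" and pos: "\<And>k. w k > 0"
    using assms by (auto simp: positive_solution_iff)
  obtain N where N: "\<And>j. \<bar>w (N + j) - 1\<bar> \<le> 1 / 10" "(\<lambda>j. w (N + j) - 1) \<longlonglongrightarrow> 0"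
    "perturbed_recurrence (\<lambda>j. w (N + j) - 1)"
    using positive_solution_small_tail[OF assms] by blast
  have "w (N + 0) - 1 \<noteq> 0"
  proof
    assume "w (N + 0) - 1 = 0"
    then have "w N = 1 \<and> w (Suc N) = 1"
      using recurrence_abs_halves[OF N(3,2,1), of 0] by simp
    with stationary_not_eventually_one[OF st pos] show False by blast
  qed
  from perturbed_recurrence_asymptotics[OF N(3,2,1) this] obtain c K where "c \<noteq> 0"
    and c: "\<And>j. \<bar>w (N + j) - 1 - c * ?l ^ j\<bar> \<le> K * (\<bar>?l\<bar>\<^sup>2) ^ j"
    by blast
  \<comment> \<open>Undoing the shift by \<open>N\<close> rescales the coefficient and the constant.\<close>
  have "(\<lambda>j. w j - 1 - (c / ?l ^ N) * ?l ^ j) \<in> O(\<lambda>j. \<bar>?l\<bar> ^ (2 * j))"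
  proof (rule bigoI)
    have "norm (w j - 1 - (c / ?l ^ N) * ?l ^ j) \<le> (K / (\<bar>?l\<bar>\<^sup>2) ^ N) * norm (\<bar>?l\<bar> ^ (2 * j))"
      if le: "j \<ge> N" for j
    proof -
      obtain i where j: "j = N + i"
        using le_Suc_ex[OF le] by blast
      have "(c / ?l ^ N) * ?l ^ j = c * ?l ^ i"
        unfolding j power_add using l by simp
      moreover have "(K / (\<bar>?l\<bar>\<^sup>2) ^ N) * norm (\<bar>?l\<bar> ^ (2 * j)) = K * (\<bar>?l\<bar>\<^sup>2) ^ i"
        using l by (simp add: j power_add power_mult)
      ultimately show ?thesis using c[of i] by (simp add: j)
    qed
    then show "\<forall>\<^sub>F j in sequentially.
        norm (w j - 1 - (c / ?l ^ N) * ?l ^ j) \<le> (K / (\<bar>?l\<bar>\<^sup>2) ^ N) * norm (\<bar>?l\<bar> ^ (2 * j))"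
      unfolding eventually_sequentially by blast
  qed
  moreover have "c / ?l ^ N \<noteq> 0" using \<open>c \<noteq> 0\<close> l by simp
  ultimately show ?thesis by blast
qed

theorem theorem1p1:
  shows "(\<exists>!w. positive_solution w) \<and>
    (\<forall>w. positive_solution w \<longrightarrow>
       (\<forall>v. is_arg_min J_functional (\<lambda>v. v \<in> admissible) v \<longleftrightarrow> v = w) \<and>
       (\<exists>c::real. c \<noteq> 0 \<and>
          (\<lambda>j. w j - 1 - c * lambda_s ^ j) \<in> O(\<lambda>j. \<bar>lambda_s\<bar> ^ (2 * j))))"
proof -
  have min: "is_arg_min J_functional (\<lambda>v. v \<in> admissible) v \<longleftrightarrow> v = w"
    if "positive_solution w" for v w
    using that positive_solution_admissible[OF that]
    by (intro positive_stationary_unique_minimizer) (auto simp: positive_solution_iff)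
  obtain w where "w \<in> admissible" "\<And>v. v \<in> admissible \<Longrightarrow> J_functional w \<le> J_functional v"
    using minimizer_exists by blast
  then have "positive_solution w"
    by (rule minimizer_positive_solution)
  moreover have "v = w" if "positive_solution v" "positive_solution w" for v w
    using min[OF that(1), of v] min[OF that(2), of v] by blast
  ultimately have "\<exists>!w. positive_solution w" by blast
  with min positive_solution_asymptotics show ?thesis by blast
qed

end
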